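(* Let $n$ be a positive integer and $f:\mathbb{R}\to\{1,\dots,n\}$ any function. Then there is $x\in\mathbb{R}$ such that the set $S_x=\{h>0: f(x-h)=f(x+h)\}$ is infinite. *)

theory Defs
  imports Complex_Main
begin

end

theory Submission
  imports Defs "HOL-Library.Z2" "HOL-Analysis.Continuum_Not_Denumerable"
begin

text \<open>
  Suppose all the sets \<open>S\<^sub>x\<close> are finite, and embed \<open>\<int>\<^sup>n\<close> into the reals by an injective
  homomorphism \<open>r\<close>. Only finitely many midpoints \<open>x\<close> come from pairs \<open>u, v\<close> with \<open>u + v\<close> bounded,
  so on the boundary of a large enough cube in \<open>\<int>\<^sup>n\<close> any two lattice points that are nearly
  antipodal have different colours. This contradicts a Lusternik--Schnirelmann theorem for \<open>n\<close>
  sets on an \<open>(n - 1)\<close>-sphere. To prove the latter, work with chains modulo two: there are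
  hemispheres \<open>h\<^sub>k\<close> made of small simplices such that the boundary of \<open>h\<^sub>k\<close> is the sum of
  \<open>h\<^sub>k\<^sub>-\<^sub>1\<close> and its antipode. For odd functions \<open>w\<^sub>0, \<dots>, w\<^sub>k\<close> with values modulo two, the cup product
  of \<open>w\<^sub>0\<close> with the coboundaries of \<open>w\<^sub>1, \<dots>, w\<^sub>k\<close> then sums to 1 over the sphere, by induction on
  \<open>k\<close> and Stokes' theorem. If each \<open>w\<^sub>j\<close> is chosen constant near the \<open>j\<close>-th colour class (and
  \<open>w\<^sub>0\<close> zero there), one factor vanishes on every small simplex.
\<close>

text \<open>Keeps sums and products of bits as ring operations, so that ring laws apply.\<close>

declare add_bit_eq_xor [simp del] mult_bit_eq_and [simp del]

lemma bit_add_self [simp]: "x + x = (0::bit)"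
  by (cases x) simp_all

lemma bit_add_self_left [simp]: "x + (x + y) = (y::bit)"
  by (simp flip: add.assoc)

section \<open>Chains modulo two\<close>

abbreviation chain_sum :: "('a list \<Rightarrow> bit) \<Rightarrow> 'a list list \<Rightarrow> bit" where
  "chain_sum \<phi> c \<equiv> sum_list (map \<phi> c)"

text \<open>Modulo two no signs are needed. A single vertex has the empty list as its face, so the
  complex is augmented.\<close>

primrec faces :: "'a list \<Rightarrow> 'a list list" where
  "faces [] = []"
| "faces (v # vs) = vs # map (Cons v) (faces vs)"

abbreviation coboundary :: "('a list \<Rightarrow> bit) \<Rightarrow> 'a list \<Rightarrow> bit" where
  "coboundary \<phi> \<sigma> \<equiv> chain_sum \<phi> (faces \<sigma>)"

text \<open>The standard prism operator: \<open>f\<close>-images up to some vertex, then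
  \<open>g\<close>-images from that same vertex on.\<close>

primrec prism :: "('a \<Rightarrow> 'b) \<Rightarrow> ('a \<Rightarrow> 'b) \<Rightarrow> 'a list \<Rightarrow> 'b list list" where
  "prism f g [] = []"
| "prism f g (v # vs) = (f v # g v # map g vs) # map (Cons (f v)) (prism f g vs)"

lemma faces_map: "faces (map g \<sigma>) = map (map g) (faces \<sigma>)"
  by (induction \<sigma>) (auto simp: comp_def)

lemma length_prism: "\<tau> \<in> set (prism f g \<sigma>) \<Longrightarrow> length \<tau> = Suc (length \<sigma>)"
  by (induction \<sigma> arbitrary: \<tau>) auto

lemma set_prism: "\<tau> \<in> set (prism f g \<sigma>) \<Longrightarrow> set \<tau> \<subseteq> f ` set \<sigma> \<union> g ` set \<sigma>"
  by (induction \<sigma> arbitrary: \<tau>) fastforce+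

lemma chain_sum_concat_map:
  "chain_sum \<phi> (concat (map F xs)) = (\<Sum>x\<leftarrow>xs. chain_sum \<phi> (F x))"
  by (induction xs) auto

text \<open>The chain homotopy identity, tested against a cochain. The faces inside the prism cancel
  in pairs; the induction hypothesis is used for \<open>\<phi>\<close> with \<open>f v\<close>
  prefixed.\<close>

lemma prism_homotopy:
  "chain_sum (coboundary \<phi>) (prism f g \<sigma>) + coboundary (\<lambda>\<tau>. chain_sum \<phi> (prism f g \<tau>)) \<sigma>
    = \<phi> (map f \<sigma>) + \<phi> (map g \<sigma>)"
proof (induction \<sigma> arbitrary: \<phi>)
  case Nil
  show ?case by simp
next
  case (Cons v vs)
  let ?\<psi> = "\<lambda>\<tau>. \<phi> (f v # \<tau>)"
  have IH: "chain_sum (coboundary ?\<psi>) (prism f g vs)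
      + coboundary (\<lambda>\<tau>. chain_sum ?\<psi> (prism f g \<tau>)) vs = ?\<psi> (map f vs) + ?\<psi> (map g vs)"
    by (rule Cons.IH)
  have "chain_sum (coboundary \<phi>) (prism f g (v # vs))
      = \<phi> (g v # map g vs) + (\<phi> (f v # map g vs)
        + (\<Sum>\<tau>\<leftarrow>faces vs. \<phi> (f v # g v # map g \<tau>)))
        + (chain_sum \<phi> (prism f g vs) + chain_sum (coboundary ?\<psi>) (prism f g vs))"
    by (simp add: comp_def faces_map sum_list_addf add.assoc)
  moreover have "coboundary (\<lambda>\<tau>. chain_sum \<phi> (prism f g \<tau>)) (v # vs)
      = chain_sum \<phi> (prism f g vs) + ((\<Sum>\<tau>\<leftarrow>faces vs. \<phi> (f v # g v # map g \<tau>))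
        + coboundary (\<lambda>\<tau>. chain_sum ?\<psi> (prism f g \<tau>)) vs)"
    by (simp add: comp_def sum_list_addf)
  ultimately have "chain_sum (coboundary \<phi>) (prism f g (v # vs))
      + coboundary (\<lambda>\<tau>. chain_sum \<phi> (prism f g \<tau>)) (v # vs)
    = \<phi> (g v # map g vs) + (\<phi> (f v # map g vs) + (chain_sum (coboundary ?\<psi>) (prism f g vs)
      + coboundary (\<lambda>\<tau>. chain_sum ?\<psi> (prism f g \<tau>)) vs))"
    by (simp only: ac_simps bit_add_self_left)
  then show ?case
    by (simp only: IH) (simp add: ac_simps)
qed

definition track :: "(nat \<Rightarrow> 'a \<Rightarrow> 'b) \<Rightarrow> nat \<Rightarrow> 'a list list \<Rightarrow> 'b list list" where
  "track H N c = concat (map (\<lambda>s. concat (map (prism (H s) (H (Suc s))) c)) [0..<N])"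

text \<open>As \<open>c\<close> is a cycle, the prisms over its boundary drop out, and the end terms
  telescope modulo two.\<close>

lemma track_homotopy:
  assumes cycle: "\<And>\<psi>. chain_sum (coboundary \<psi>) c = 0"
  shows "chain_sum (coboundary \<phi>) (track H N c)
    = (\<Sum>\<sigma>\<leftarrow>c. \<phi> (map (H 0) \<sigma>)) + (\<Sum>\<sigma>\<leftarrow>c. \<phi> (map (H N) \<sigma>))"
proof (induction N)
  case 0
  show ?case by (simp add: track_def)
next
  case (Suc N)
  have "(\<Sum>\<sigma>\<leftarrow>c. chain_sum (coboundary \<phi>) (prism (H N) (H (Suc N)) \<sigma>))
      = (\<Sum>\<sigma>\<leftarrow>c. chain_sum (coboundary \<phi>) (prism (H N) (H (Suc N)) \<sigma>)
          + coboundary (\<lambda>\<tau>. chain_sum \<phi> (prism (H N) (H (Suc N)) \<tau>)) \<sigma>)"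
    by (simp only: sum_list_addf cycle add_0_right)
  also have "\<dots> = (\<Sum>\<sigma>\<leftarrow>c. \<phi> (map (H N) \<sigma>)) + (\<Sum>\<sigma>\<leftarrow>c. \<phi> (map (H (Suc N)) \<sigma>))"
    by (simp only: prism_homotopy sum_list_addf)
  finally have "(\<Sum>\<sigma>\<leftarrow>c. chain_sum (coboundary \<phi>) (prism (H N) (H (Suc N)) \<sigma>))
      = (\<Sum>\<sigma>\<leftarrow>c. \<phi> (map (H N) \<sigma>)) + (\<Sum>\<sigma>\<leftarrow>c. \<phi> (map (H (Suc N)) \<sigma>))" .
  moreover have "chain_sum (coboundary \<phi>) (track H (Suc N) c)
      = chain_sum (coboundary \<phi>) (track H N c)
        + (\<Sum>\<sigma>\<leftarrow>c. chain_sum (coboundary \<phi>) (prism (H N) (H (Suc N)) \<sigma>))"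
    by (simp add: track_def chain_sum_concat_map)
  ultimately show ?case
    by (simp add: Suc.IH add.assoc)
qed

lemma set_trackE:
  assumes "\<tau> \<in> set (track H N c)"
  obtains s \<sigma> where "s < N" "\<sigma> \<in> set c" "\<tau> \<in> set (prism (H s) (H (Suc s)) \<sigma>)"
  using assms by (auto simp: track_def)

section \<open>Cup products of coboundaries of vertex functions\<close>

text \<open>Alexander-Whitney formula: each coboundary is evaluated on its own edge; lists of the
  wrong length give 0.\<close>

fun cup_diffs :: "('a \<Rightarrow> bit) list \<Rightarrow> 'a list \<Rightarrow> bit" where
  "cup_diffs [] [v] = 1"
| "cup_diffs (w # ws) (v # u # vs) = (w v + w u) * cup_diffs ws (u # vs)"
| "cup_diffs _ _ = 0"

fun cup :: "('a \<Rightarrow> bit) list \<Rightarrow> 'a list \<Rightarrow> bit" where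
  "cup (w # ws) (v # vs) = w v * cup_diffs ws (v # vs)"
| "cup _ _ = 0"

text \<open>Leibniz rule: every factor is a cocycle. Omitting either of the first two vertices gives
  multiples of \<open>A\<close> whose coefficients add up to \<open>w u + w v\<close>, as
  \<open>w x\<close> cancels.\<close>

lemma coboundary_cup_diffs:
  "length \<sigma> = length ws + 2 \<Longrightarrow> coboundary (cup_diffs ws) \<sigma> = 0"
proof (induction ws arbitrary: \<sigma>)
  case Nil
  then obtain v u where "\<sigma> = [v, u]"
    by (auto simp: length_Suc_conv numeral_2_eq_2)
  then show ?case by simp
next
  case (Cons w ws)
  then obtain v u x vs where \<sigma>: "\<sigma> = v # u # x # vs" and len: "length vs = length ws"
    by (auto simp: length_Suc_conv numeral_2_eq_2)
  have IH: "coboundary (cup_diffs ws) (u # x # vs) = 0"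
    using Cons.IH[of "u # x # vs"] len by simp
  define A where "A = cup_diffs ws (x # vs)"
  define B where "B = (\<Sum>\<tau>\<leftarrow>faces (x # vs). cup_diffs ws (u # \<tau>))"
  have AB: "A + B = 0"
    using IH unfolding A_def B_def by (simp add: comp_def)
  have "coboundary (cup_diffs (w # ws)) \<sigma>
      = (w u + w x) * A + ((w v + w x) * A + (w v + w u) * B)"
    unfolding A_def B_def
    by (simp add: \<sigma> comp_def sum_list_const_mult distrib_left)
  also have "\<dots> = (w u + w v) * (A + B)"
    by (cases "w u"; cases "w v"; cases "w x"; cases A; cases B) simp_all
  finally show ?case
    by (simp add: AB)
qed

lemma coboundary_cup:
  assumes "length \<sigma> = length ws + 2"
  shows "coboundary (cup (w # ws)) \<sigma> = cup_diffs (w # ws) \<sigma>"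
proof -
  obtain v u vs where \<sigma>: "\<sigma> = v # u # vs"
    using assms by (auto simp: length_Suc_conv numeral_2_eq_2)
  have "cup_diffs ws (u # vs) + (\<Sum>\<tau>\<leftarrow>faces (u # vs). cup_diffs ws (v # \<tau>)) = 0"
    using coboundary_cup_diffs[OF assms] by (simp add: \<sigma> comp_def)
  then have "(\<Sum>\<tau>\<leftarrow>faces (u # vs). cup_diffs ws (v # \<tau>)) = cup_diffs ws (u # vs)"
    by (metis add.right_neutral bit_add_self_left)
  moreover have "coboundary (cup (w # ws)) \<sigma>
      = w u * cup_diffs ws (u # vs)
        + w v * (\<Sum>\<tau>\<leftarrow>faces (u # vs). cup_diffs ws (v # \<tau>))"
    by (simp add: \<sigma> comp_def sum_list_const_mult distrib_left)
  ultimately show ?thesis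
    by (simp add: \<sigma> algebra_simps)
qed

lemma cup_diffs_antipodal:
  assumes "\<And>w v. w \<in> set ws \<Longrightarrow> v \<in> set \<sigma> \<Longrightarrow> w (a v) = w v + 1"
  shows "cup_diffs ws (map a \<sigma>) = cup_diffs ws \<sigma>"
  using assms
proof (induction ws \<sigma> rule: cup_diffs.induct)
  case (2 w ws v u vs)
  have "w (a v) + w (a u) = w v + w u"
    using 2(2)[of w v] 2(2)[of w u] by (cases "w v"; cases "w u") simp_all
  with 2 show ?case by simp
qed auto

text \<open>Coboundaries of odd functions are even, so only the leading factor changes, and its two
  values add up to 1.\<close>

lemma cup_antipodal:
  assumes "\<And>w' v. w' \<in> set (w # ws) \<Longrightarrow> v \<in> set \<sigma> \<Longrightarrow> w' (a v) = w' v + 1"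
    and "\<sigma> \<noteq> []"
  shows "cup (w # ws) \<sigma> + cup (w # ws) (map a \<sigma>) = cup_diffs ws \<sigma>"
proof -
  obtain v vs where \<sigma>: "\<sigma> = v # vs"
    using assms(2) by (cases \<sigma>) auto
  have "cup_diffs ws (map a \<sigma>) = cup_diffs ws \<sigma>"
    using assms(1) by (intro cup_diffs_antipodal) auto
  moreover have "w (a v) = w v + 1"
    using assms(1) by (simp add: \<sigma>)
  ultimately show ?thesis
    by (simp add: \<sigma> distrib_right)
qed

lemma cup_diffs_nonzero:
  "cup_diffs ws \<sigma> \<noteq> 0 \<Longrightarrow> length \<sigma> = Suc (length ws) \<and>
    (\<forall>i<length ws. (ws ! i) (\<sigma> ! i) \<noteq> (ws ! i) (\<sigma> ! Suc i))"
proof (induction ws \<sigma> rule: cup_diffs.induct)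
  case (2 w ws v u vs)
  then have "w v \<noteq> w u" "cup_diffs ws (u # vs) \<noteq> 0"
    by auto
  with 2 show ?case
    by (auto simp: nth_Cons split: nat.splits)
qed auto

section \<open>Antipodal spheres in the integer lattice\<close>

definition antipode :: "(nat \<Rightarrow> int) \<Rightarrow> nat \<Rightarrow> int" where
  "antipode v = (\<lambda>i. - v i)"

text \<open>Zero padding makes each sphere literally the equator of the next one.\<close>

definition cube_sphere :: "nat \<Rightarrow> nat \<Rightarrow> (nat \<Rightarrow> int) set" where
  "cube_sphere k \<rho> = {v. (\<forall>i. \<bar>v i\<bar> \<le> int \<rho>) \<and> (\<forall>i>k. v i = 0) \<and> (\<exists>i\<le>k. \<bar>v i\<bar> = int \<rho>)}"

definition near :: "nat \<Rightarrow> (nat \<Rightarrow> int) \<Rightarrow> (nat \<Rightarrow> int) \<Rightarrow> bool" where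
  "near K v u \<longleftrightarrow> (\<forall>i. \<bar>v i - u i\<bar> \<le> int K)"

text \<open>Contracts the equator to the pole: coordinate \<open>k\<close> is first raised to \<open>\<rho>\<close>, then the other
  coordinates are clamped to ever smaller intervals, so the whole path stays on the cube sphere.\<close>
definition lift_and_clamp :: "nat \<Rightarrow> nat \<Rightarrow> nat \<Rightarrow> (nat \<Rightarrow> int) \<Rightarrow> nat \<Rightarrow> int" where
  "lift_and_clamp k \<rho> s v = (\<lambda>i. if i = k then min (int s) (int \<rho>)
     else max (int s - 2 * int \<rho>) (min (2 * int \<rho> - int s) (v i)))"

definition double :: "(nat \<Rightarrow> int) list list \<Rightarrow> (nat \<Rightarrow> int) list list" where
  "double c = c @ map (map antipode) c"

text \<open>Swept out by the previous sphere, as equator, contracting to the pole: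
  \<open>\<rho>\<close> steps of raising, then \<open>\<rho>\<close> of clamping.\<close>

primrec hemisphere :: "nat \<Rightarrow> nat \<Rightarrow> (nat \<Rightarrow> int) list list" where
  "hemisphere \<rho> 0 = [[\<lambda>i. if i = 0 then int \<rho> else 0]]"
| "hemisphere \<rho> (Suc k) =
    track (lift_and_clamp (Suc k) \<rho>) (2 * \<rho>) (double (hemisphere \<rho> k))"

lemma antipode_antipode [simp]: "antipode (antipode v) = v"
  by (simp add: antipode_def)

lemma map_antipode_antipode [simp]: "map antipode (map antipode \<sigma>) = \<sigma>"
  by (simp add: comp_def)

lemma antipode_in_cube_sphere: "v \<in> cube_sphere k \<rho> \<Longrightarrow> antipode v \<in> cube_sphere k \<rho>"
  by (simp add: cube_sphere_def antipode_def)

lemma near_antipode: "near K v u \<Longrightarrow> near K (antipode v) (antipode u)"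
  by (simp add: near_def antipode_def abs_minus_commute)

lemma near_sym: "near K v u \<Longrightarrow> near K u v"
  by (simp add: near_def abs_minus_commute)

lemma cube_sphere_Suc: "cube_sphere k \<rho> \<subseteq> cube_sphere (Suc k) \<rho>"
  by (auto simp: cube_sphere_def intro: le_SucI)

lemma lift_and_clamp_in_cube_sphere:
  assumes "v \<in> cube_sphere k \<rho>" "s \<le> 2 * \<rho>"
  shows "lift_and_clamp (Suc k) \<rho> s v \<in> cube_sphere (Suc k) \<rho>"
proof -
  have bnd: "\<bar>v i\<bar> \<le> int \<rho>" for i
    using assms(1) by (simp add: cube_sphere_def)
  have "\<bar>lift_and_clamp (Suc k) \<rho> s v i\<bar> \<le> int \<rho>" for i
    using bnd[of i] assms(2) by (auto simp: lift_and_clamp_def)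
  moreover have "lift_and_clamp (Suc k) \<rho> s v i = 0" if "i > Suc k" for i
    using that assms by (auto simp: lift_and_clamp_def cube_sphere_def)
  moreover have "\<exists>i\<le>Suc k. \<bar>lift_and_clamp (Suc k) \<rho> s v i\<bar> = int \<rho>"
  \<comment> \<open>While the new coordinate rises, the clamp is inactive and an old extreme
    coordinate survives; afterwards the new one equals \<open>\<rho>\<close>.\<close>
  proof (cases "s \<le> \<rho>")
    case True
    obtain i where i: "i \<le> k" "\<bar>v i\<bar> = int \<rho>"
      using assms(1) by (auto simp: cube_sphere_def)
    then have "\<bar>lift_and_clamp (Suc k) \<rho> s v i\<bar> = int \<rho>"
      using True by (auto simp: lift_and_clamp_def)
    with i show ?thesis by (meson le_SucI)
  next
    case False
    then have "\<bar>lift_and_clamp (Suc k) \<rho> s v (Suc k)\<bar> = int \<rho>"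
      by (simp add: lift_and_clamp_def)
    then show ?thesis by blast
  qed
  ultimately show ?thesis
    by (simp add: cube_sphere_def)
qed

lemma abs_min_diff_le:
  fixes a b x y :: "'a::linordered_idom"
  assumes "\<bar>a - b\<bar> \<le> d" "\<bar>x - y\<bar> \<le> d"
  shows "\<bar>min a x - min b y\<bar> \<le> d"
  using assms by (auto simp: min_def abs_le_iff algebra_simps)

lemma abs_max_diff_le:
  fixes a b x y :: "'a::linordered_idom"
  assumes "\<bar>a - b\<bar> \<le> d" "\<bar>x - y\<bar> \<le> d"
  shows "\<bar>max a x - max b y\<bar> \<le> d"
  using assms by (auto simp: max_def abs_le_iff algebra_simps)

text \<open>Clamping is nonexpansive and its bounds move by at most one per step, so each dimension
  adds one to the mesh, whatever \<open>\<rho>\<close> is.\<close>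

lemma near_lift_and_clamp:
  assumes "near K v u" "s \<le> Suc t" "t \<le> Suc s"
  shows "near (Suc K) (lift_and_clamp k \<rho> s v) (lift_and_clamp k \<rho> t u)"
  unfolding near_def
proof
  fix i
  have "\<bar>v i - u i\<bar> \<le> int K"
    using assms(1) by (simp add: near_def)
  moreover have "\<bar>int s - int t\<bar> \<le> 1"
    using assms(2,3) by linarith
  ultimately show "\<bar>lift_and_clamp k \<rho> s v i - lift_and_clamp k \<rho> t u i\<bar> \<le> int (Suc K)"
    unfolding lift_and_clamp_def by (auto intro!: abs_max_diff_le abs_min_diff_le)
qed

lemma lift_and_clamp_start:
  assumes "v \<in> cube_sphere k \<rho>"
  shows "lift_and_clamp (Suc k) \<rho> 0 v = v"
proof
  fix i
  have "\<bar>v i\<bar> \<le> int \<rho>" "v (Suc k) = 0"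
    using assms by (auto simp: cube_sphere_def)
  then show "lift_and_clamp (Suc k) \<rho> 0 v i = v i"
    by (auto simp: lift_and_clamp_def)
qed

lemma lift_and_clamp_end:
  "lift_and_clamp k \<rho> (2 * \<rho>) = (\<lambda>_ i. if i = k then int \<rho> else 0)"
  by (auto simp: lift_and_clamp_def fun_eq_iff)

lemma double_simplex_if:
  assumes "\<And>\<sigma>. \<sigma> \<in> set c \<Longrightarrow> length \<sigma> = m \<and> set \<sigma> \<subseteq> cube_sphere k \<rho> \<and>
      (\<forall>v\<in>set \<sigma>. \<forall>u\<in>set \<sigma>. near K v u)"
    and "\<sigma> \<in> set (double c)"
  shows "length \<sigma> = m \<and> set \<sigma> \<subseteq> cube_sphere k \<rho> \<and> (\<forall>v\<in>set \<sigma>. \<forall>u\<in>set \<sigma>. near K v u)"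
proof -
  consider "\<sigma> \<in> set c" | \<tau> where "\<tau> \<in> set c" "\<sigma> = map antipode \<tau>"
    using assms(2) by (auto simp: double_def)
  then show ?thesis
  proof cases
    case 1
    then show ?thesis by (rule assms(1))
  next
    case (2 \<tau>)
    with assms(1)[OF 2(1)] show ?thesis
      by (auto intro: antipode_in_cube_sphere near_antipode)
  qed
qed

lemma hemisphere_simplex:
  "\<sigma> \<in> set (hemisphere \<rho> k) \<Longrightarrow> length \<sigma> = Suc k \<and> set \<sigma> \<subseteq> cube_sphere k \<rho> \<and>
    (\<forall>v\<in>set \<sigma>. \<forall>u\<in>set \<sigma>. near k v u)"
proof (induction k arbitrary: \<sigma>)
  case 0
  then show ?case
    by (auto simp: cube_sphere_def near_def)
next
  case (Suc k)
  let ?H = "lift_and_clamp (Suc k) \<rho>"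
  from Suc.prems obtain s \<tau> where s: "s < 2 * \<rho>" and \<tau>: "\<tau> \<in> set (double (hemisphere \<rho> k))"
    and \<sigma>: "\<sigma> \<in> set (prism (?H s) (?H (Suc s)) \<tau>)"
    by (auto elim: set_trackE)
  have \<tau>_props: "length \<tau> = Suc k \<and> set \<tau> \<subseteq> cube_sphere k \<rho> \<and>
      (\<forall>v\<in>set \<tau>. \<forall>u\<in>set \<tau>. near k v u)"
    by (rule double_simplex_if[OF Suc.IH \<tau>])
  have verts: "\<exists>t u. (t = s \<or> t = Suc s) \<and> u \<in> set \<tau> \<and> v = ?H t u" if "v \<in> set \<sigma>" for v
    using set_prism[OF \<sigma>] that by blast
  have "length \<sigma> = Suc (Suc k)"
    using length_prism[OF \<sigma>] \<tau>_props by simp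
  moreover have "set \<sigma> \<subseteq> cube_sphere (Suc k) \<rho>"
  proof
    fix v assume "v \<in> set \<sigma>"
    from verts[OF this] obtain t u where t: "t = s \<or> t = Suc s"
        and u: "u \<in> set \<tau>" and v: "v = ?H t u"
      by blast
    show "v \<in> cube_sphere (Suc k) \<rho>"
      unfolding v using \<tau>_props u s t by (intro lift_and_clamp_in_cube_sphere) auto
  qed
  moreover have "near (Suc k) v u" if v: "v \<in> set \<sigma>" and u: "u \<in> set \<sigma>" for v u
  proof -
    obtain t v' where v': "t = s \<or> t = Suc s" "v' \<in> set \<tau>" "v = ?H t v'"
      using verts[OF v] by blast
    obtain t' u' where u': "t' = s \<or> t' = Suc s" "u' \<in> set \<tau>" "u = ?H t' u'"
      using verts[OF u] by blast
    have "near k v' u'"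
      using \<tau>_props v'(2) u'(2) by blast
    then show ?thesis
      unfolding v'(3) u'(3) by (rule near_lift_and_clamp) (use v'(1) u'(1) in auto)
  qed
  ultimately show ?case by blast
qed

section \<open>Boundaries of hemispheres and Stokes' theorem\<close>

lemma chain_sum_double:
  "chain_sum \<phi> (double c) = chain_sum \<phi> c + chain_sum (\<lambda>\<sigma>. \<phi> (map antipode \<sigma>)) c"
  by (simp add: double_def comp_def)

lemma double_simplex:
  assumes "\<sigma> \<in> set (double (hemisphere \<rho> k))"
  shows "length \<sigma> = Suc k \<and> set \<sigma> \<subseteq> cube_sphere k \<rho> \<and> (\<forall>v\<in>set \<sigma>. \<forall>u\<in>set \<sigma>. near k v u)"
  by (rule double_simplex_if[OF hemisphere_simplex assms])

lemma sum_list_const_bit: "(\<Sum>x\<leftarrow>c @ map f c. b) = (0::bit)"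
  by (simp add: comp_def)

text \<open>The contracted end of the track is a single degenerate simplex taken an even number of
  times, hence zero.\<close>
lemma hemisphere_boundary:
  assumes cycle: "\<And>\<psi>. chain_sum (coboundary \<psi>) (double (hemisphere \<rho> k)) = 0"
  shows "chain_sum (coboundary \<phi>) (hemisphere \<rho> (Suc k)) = chain_sum \<phi> (double (hemisphere \<rho> k))"
proof -
  let ?z = "double (hemisphere \<rho> k)" and ?H = "lift_and_clamp (Suc k) \<rho>"
  have "map (?H 0) \<sigma> = \<sigma>" if "\<sigma> \<in> set ?z" for \<sigma>
    using double_simplex[OF that] by (intro map_idI lift_and_clamp_start) blast
  then have start: "(\<Sum>\<sigma>\<leftarrow>?z. \<phi> (map (?H 0) \<sigma>)) = chain_sum \<phi> ?z"
    by (intro arg_cong[where f = sum_list] map_cong) auto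
  let ?p = "replicate (Suc k) (\<lambda>i. if i = Suc k then int \<rho> else 0)"
  have "map (?H (2 * \<rho>)) \<sigma> = ?p" if "\<sigma> \<in> set ?z" for \<sigma>
    using double_simplex[OF that] by (simp only: lift_and_clamp_end map_replicate_const)
  then have "(\<Sum>\<sigma>\<leftarrow>?z. \<phi> (map (?H (2 * \<rho>)) \<sigma>)) = (\<Sum>\<sigma>\<leftarrow>?z. \<phi> ?p)"
    by (intro arg_cong[where f = sum_list] map_cong) auto
  also have "\<dots> = 0"
    unfolding double_def by (rule sum_list_const_bit)
  finally have "(\<Sum>\<sigma>\<leftarrow>?z. \<phi> (map (?H (2 * \<rho>)) \<sigma>)) = 0" .
  with start show ?thesis
    by (simp add: track_homotopy[OF cycle])
qed

text \<open>The boundary of a hemisphere is antipodally invariant, so those of opposite hemispheres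
  cancel. The induction supplies the cycle condition for \<open>hemisphere_boundary\<close>.\<close>

lemma double_hemisphere_cycle: "chain_sum (coboundary \<phi>) (double (hemisphere \<rho> k)) = 0"
proof (induction k arbitrary: \<phi>)
  case 0
  show ?case by (simp add: double_def)
next
  case (Suc k)
  have "coboundary \<phi> (map antipode \<sigma>) = coboundary (\<lambda>\<tau>. \<phi> (map antipode \<tau>)) \<sigma>" for \<sigma>
    by (simp add: faces_map comp_def)
  then have "chain_sum (coboundary \<phi>) (double (hemisphere \<rho> (Suc k)))
      = chain_sum (coboundary \<phi>) (hemisphere \<rho> (Suc k))
        + chain_sum (coboundary (\<lambda>\<tau>. \<phi> (map antipode \<tau>))) (hemisphere \<rho> (Suc k))"
    by (simp only: chain_sum_double)
  also have "\<dots> = chain_sum \<phi> (double (hemisphere \<rho> k))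
      + chain_sum (\<lambda>\<tau>. \<phi> (map antipode \<tau>)) (double (hemisphere \<rho> k))"
    by (simp only: hemisphere_boundary[OF Suc.IH])
  also have "\<dots> = 0"
    by (simp only: chain_sum_double map_antipode_antipode) (simp add: ac_simps)
  finally show ?case .
qed

text \<open>A combinatorial form of the Borsuk--Ulam theorem.\<close>
lemma chain_sum_cup_sphere:
  assumes "length ws = k"
    and "\<And>w' v. w' \<in> set (w # ws) \<Longrightarrow> v \<in> cube_sphere k \<rho> \<Longrightarrow> w' (antipode v) = w' v + 1"
  shows "chain_sum (cup (w # ws)) (double (hemisphere \<rho> k)) = 1"
  using assms
proof (induction k arbitrary: w ws)
  case 0
  define p :: "nat \<Rightarrow> int" where "p = (\<lambda>i. if i = 0 then int \<rho> else 0)"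
  have "p \<in> cube_sphere 0 \<rho>"
    by (auto simp: p_def cube_sphere_def)
  then have "w (antipode p) = w p + 1"
    using 0 by simp
  then show ?case
    using 0 by (simp add: double_def flip: p_def)
next
  case (Suc k)
  then obtain w1 ws1 where ws: "ws = w1 # ws1" and len: "length ws1 = k"
    by (auto simp: length_Suc_conv)
  have "chain_sum (cup (w # ws)) (double (hemisphere \<rho> (Suc k)))
      = (\<Sum>\<sigma>\<leftarrow>hemisphere \<rho> (Suc k). cup (w # ws) \<sigma> + cup (w # ws) (map antipode \<sigma>))"
    by (simp only: chain_sum_double sum_list_addf)
  \<comment> \<open>Opposite values add up to the product without its leading factor, which is a
    coboundary; Stokes then moves the sum to the equator.\<close>
  also have "\<dots> = (\<Sum>\<sigma>\<leftarrow>hemisphere \<rho> (Suc k). coboundary (cup ws) \<sigma>)"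
  proof (intro arg_cong[where f = sum_list] map_cong refl)
    fix \<sigma> assume "\<sigma> \<in> set (hemisphere \<rho> (Suc k))"
    then have \<sigma>: "length \<sigma> = Suc (Suc k)" "set \<sigma> \<subseteq> cube_sphere (Suc k) \<rho>"
      by (blast dest: hemisphere_simplex)+
    have "cup (w # ws) \<sigma> + cup (w # ws) (map antipode \<sigma>) = cup_diffs ws \<sigma>"
      using \<sigma> Suc.prems(2) by (intro cup_antipodal) auto
    also have "\<dots> = coboundary (cup ws) \<sigma>"
      unfolding ws using \<sigma> len by (intro coboundary_cup[symmetric]) simp
    finally show "cup (w # ws) \<sigma> + cup (w # ws) (map antipode \<sigma>) = coboundary (cup ws) \<sigma>" .
  qed
  also have "\<dots> = chain_sum (cup ws) (double (hemisphere \<rho> k))"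
    by (rule hemisphere_boundary[OF double_hemisphere_cycle])
  also have "\<dots> = 1"
    unfolding ws using Suc.prems(2) cube_sphere_Suc[of k \<rho>] len
    by (intro Suc.IH) (auto simp: ws)
  finally show ?case .
qed

text \<open>A sum equal to 1 has a nonzero term, and a nonzero product has no zero factor.\<close>

lemma odd_functions_alternating_simplex:
  fixes w :: "(nat \<Rightarrow> int) \<Rightarrow> bit"
  assumes "length ws = k"
    and "\<And>w' v. w' \<in> set (w # ws) \<Longrightarrow> v \<in> cube_sphere k \<rho> \<Longrightarrow> w' (antipode v) = w' v + 1"
  obtains \<sigma> where "length \<sigma> = Suc k" "set \<sigma> \<subseteq> cube_sphere k \<rho>"
    "\<And>v u. v \<in> set \<sigma> \<Longrightarrow> u \<in> set \<sigma> \<Longrightarrow> near k v u" "w (\<sigma> ! 0) = 1"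
    "\<And>i. i < k \<Longrightarrow> (ws ! i) (\<sigma> ! i) \<noteq> (ws ! i) (\<sigma> ! Suc i)"
proof -
  have "\<exists>\<sigma>\<in>set (double (hemisphere \<rho> k)). cup (w # ws) \<sigma> \<noteq> 0"
  proof (rule ccontr)
    assume "\<not> ?thesis"
    then have "chain_sum (cup (w # ws)) (double (hemisphere \<rho> k)) = 0"
      by (simp add: sum_list_0 map_idI cong: map_cong)
    then show False
      using chain_sum_cup_sphere[OF assms] by simp
  qed
  then obtain \<sigma> where \<sigma>: "\<sigma> \<in> set (double (hemisphere \<rho> k))" "cup (w # ws) \<sigma> \<noteq> 0"
    by blast
  obtain v vs where vs: "\<sigma> = v # vs"
    using \<sigma>(2) by (cases \<sigma>) auto
  have "w (\<sigma> ! 0) = 1" "cup_diffs ws \<sigma> \<noteq> 0"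
    using \<sigma>(2) by (auto simp: vs)
  then show ?thesis
    using double_simplex[OF \<sigma>(1)] cup_diffs_nonzero[of ws \<sigma>] assms(1) by (intro that) auto
qed

section \<open>Embedding the lattice into the reals\<close>

definition combination :: "nat \<Rightarrow> (nat \<Rightarrow> real) \<Rightarrow> (nat \<Rightarrow> int) \<Rightarrow> real" where
  "combination n b v = (\<Sum>i<n. of_int (v i) * b i)"

text \<open>Each new real only has to avoid the countably many values that complete an integer
  relation with the earlier ones.\<close>

lemma ex_integrally_independent_reals:
  "\<exists>b. \<forall>v. combination n b v = 0 \<longrightarrow> (\<forall>i<n. v i = 0)"
proof (induction n)
  case 0
  show ?case by simp
next
  case (Suc n)
  then obtain b where b: "\<And>v i. combination n b v = 0 \<Longrightarrow> i < n \<Longrightarrow> v i = 0"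
    by blast
  \<comment> \<open>Lists encode coefficients because there are uncountably many functions on
    \<open>nat\<close>; \<open>m = 0\<close> merely contributes the value 0.\<close>
  define B where "B = range (\<lambda>(l :: int list, m :: int). - combination n b ((!) l) / of_int m)"
  have "countable B"
    by (simp add: B_def)
  then obtain c where c: "c \<notin> B"
    using uncountable_UNIV_real by (metis UNIV_eq_I)
  have "\<forall>i<Suc n. v i = 0" if eq: "combination (Suc n) (b(n := c)) v = 0" for v
  proof -
    have sum: "combination n b v + of_int (v n) * c = 0"
      using eq by (simp add: combination_def)
    have "v n = 0"
    proof (rule ccontr)
      assume "v n \<noteq> 0"
      then have "c = - combination n b v / of_int (v n)"
        using sum by (simp add: field_simps)
      also have "combination n b v = combination n b ((!) (map v [0..<n]))"
        by (simp add: combination_def)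
      finally have "c \<in> B"
        unfolding B_def by (intro range_eqI[of _ _ "(map v [0..<n], v n)"]) simp
      with c show False ..
    qed
    then show ?thesis
      using sum b by (auto simp: less_Suc_eq)
  qed
  then show ?case by blast
qed

lemma combination_add: "combination n b v + combination n b u = combination n b (\<lambda>i. v i + u i)"
  by (simp add: combination_def sum.distrib distrib_right)

lemma combination_antipode: "combination n b (antipode v) = - combination n b v"
  by (simp add: combination_def antipode_def sum_negf)

lemma finite_image_combination_bounded:
  "finite (combination n b ` {v. \<forall>i. \<bar>v i\<bar> \<le> int M})"
proof -
  have "combination n b ` {v. \<forall>i. \<bar>v i\<bar> \<le> int M}
      \<subseteq> (\<lambda>l. combination n b ((!) l)) ` {l. set l \<subseteq> {- int M..int M} \<and> length l = n}"
  proof (intro image_subsetI)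
    fix v :: "nat \<Rightarrow> int" assume v: "v \<in> {v. \<forall>i. \<bar>v i\<bar> \<le> int M}"
    have "combination n b v = combination n b ((!) (map v [0..<n]))"
      by (simp add: combination_def)
    moreover have "map v [0..<n] \<in> {l. set l \<subseteq> {- int M..int M} \<and> length l = n}"
      using v by (auto simp: abs_le_iff minus_le_iff)
    ultimately show "combination n b v
        \<in> (\<lambda>l. combination n b ((!) l)) ` {l. set l \<subseteq> {- int M..int M} \<and> length l = n}"
      by blast
  qed
  then show ?thesis
    by (rule finite_subset) (simp add: finite_lists_length_eq)
qed

text \<open>By independence each value in \<open>E\<close> determines the coordinates up to
  \<open>k\<close> of any preimage; \<open>\<rho>\<close> exceeds the resulting bounds.\<close>

lemma cube_sphere_avoids_finite:
  assumes b: "\<And>v. combination (Suc k) b v = 0 \<Longrightarrow> \<forall>i<Suc k. v i = 0"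
    and "finite E"
  obtains \<rho> where "\<rho> > M" "\<And>v. v \<in> cube_sphere k \<rho> \<Longrightarrow> combination (Suc k) b v \<notin> E"
proof -
  let ?r = "combination (Suc k) b"
  have "\<exists>N. \<forall>v i. ?r v = e \<longrightarrow> i \<le> k \<longrightarrow> \<bar>v i\<bar> \<le> int N" for e
  proof (cases "\<exists>v. ?r v = e")
    case True
    then obtain u where u: "?r u = e" ..
    have "\<bar>v i\<bar> \<le> int (nat (\<Sum>j\<le>k. \<bar>u j\<bar>))" if "?r v = e" "i \<le> k" for v i
    proof -
      have "?r (\<lambda>i. v i + antipode u i) = 0"
        using that u by (simp add: combination_antipode flip: combination_add)
      from b[OF this] have "v i = u i"
        using that by (simp add: antipode_def less_Suc_eq_le)
      moreover have "\<bar>u i\<bar> \<le> (\<Sum>j\<le>k. \<bar>u j\<bar>)"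
        using that by (intro member_le_sum) auto
      ultimately show ?thesis
        by simp
    qed
    then show ?thesis by blast
  qed blast
  then obtain N where N: "\<And>e v i. ?r v = e \<Longrightarrow> i \<le> k \<Longrightarrow> \<bar>v i\<bar> \<le> int (N e)"
    by metis
  define \<rho> where "\<rho> = Suc (M + (\<Sum>e\<in>E. N e))"
  show thesis
  proof
    show "\<rho> > M"
      by (simp add: \<rho>_def)
    fix v assume "v \<in> cube_sphere k \<rho>"
    then obtain i where i: "i \<le> k" "\<bar>v i\<bar> = int \<rho>"
      by (auto simp: cube_sphere_def)
    show "?r v \<notin> E"
    proof
      assume "?r v \<in> E"
      then have "N (?r v) \<le> (\<Sum>e\<in>E. N e)"
        using assms(2) by (intro member_le_sum) auto
      moreover have "int \<rho> \<le> int (N (?r v))"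
        using N[OF refl i(1), of v] i(2) by simp
      ultimately show False
        by (simp add: \<rho>_def del: of_nat_sum)
    qed
  qed
qed

section \<open>Colour classes on a large cube sphere\<close>

theorem theorem7:
  fixes n :: nat and f :: "real \<Rightarrow> nat"
  assumes "n > 0"
    and "\<And>x. f x \<in> {1..n}"
  shows "\<exists>x::real. infinite {h::real. h > 0 \<and> f (x - h) = f (x + h)}"
proof (rule ccontr)
  assume "\<not> ?thesis"
  then have fin: "finite {h::real. h > 0 \<and> f (x - h) = f (x + h)}" for x
    by blast
  obtain k where n: "n = Suc k"
    using assms(1) gr0_implies_Suc by blast
  obtain b where b: "\<And>v. combination n b v = 0 \<Longrightarrow> \<forall>i<n. v i = 0"
    using ex_integrally_independent_reals by blast
  define r where "r = combination n b"
  \<comment> \<open>\<open>X\<close> holds the midpoints of nearly antipodal pairs, \<open>E\<close>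
    the right endpoints of equally coloured pairs around them. The tolerance \<open>2 * k\<close>
    comes from two detours of size \<open>k\<close> in \<open>excl\<close>.\<close>
  define X where "X = (\<lambda>y. y / 2) ` r ` {v. \<forall>i. \<bar>v i\<bar> \<le> int (2 * k)}"
  define E where "E = (\<Union>x\<in>X. (\<lambda>h. x + h) ` {h. h > 0 \<and> f (x - h) = f (x + h)})"
  have "finite X"
    unfolding X_def r_def by (intro finite_imageI finite_image_combination_bounded)
  then have "finite E"
    unfolding E_def using fin by blast
  \<comment> \<open>\<open>\<rho> > k\<close> keeps a point from being nearly antipodal to itself;
    excluding 0 makes the sign of \<open>r v\<close> an odd default for \<open>lab\<close>.\<close>
  then obtain \<rho> where \<rho>: "\<rho> > k" and avoid: "\<And>v. v \<in> cube_sphere k \<rho> \<Longrightarrow> r v \<notin> insert 0 E"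
    using cube_sphere_avoids_finite[of k b "insert 0 E" k] b unfolding r_def n by auto

  have less: "f (r v) \<noteq> f (r u)"
    if "v \<in> cube_sphere k \<rho>" "near (2 * k) v (antipode u)" "r u < r v" for v u
  proof
    assume eq: "f (r v) = f (r u)"
    define x where "x = (r v + r u) / 2"
    define h where "h = (r v - r u) / 2"
    have "r v + r u = r (\<lambda>i. v i + u i)"
      by (simp add: r_def combination_add)
    then have "x \<in> X"
      using that(2) by (auto simp: x_def X_def near_def antipode_def)
    moreover have "x + h = r v" "x - h = r u" "h > 0"
      using that(3) by (simp_all add: x_def h_def field_simps)
    ultimately have "r v \<in> E"
      unfolding E_def using eq by force
    with avoid[OF that(1)] show False by simp
  qed
  have distinct: "f (r v) \<noteq> f (r u)"
    if v: "v \<in> cube_sphere k \<rho>" and u: "u \<in> cube_sphere k \<rho>"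
      and near: "near (2 * k) v (antipode u)" for v u
  proof -
    have near': "near (2 * k) u (antipode v)"
      using near_antipode[OF near_sym[OF near]] by simp
    have "r u \<noteq> r v"
    proof
      assume "r u = r v"
      then have "combination n b (\<lambda>i. v i + antipode u i) = 0"
        by (simp add: r_def combination_antipode flip: combination_add)
      from b[OF this] have eq: "v i = u i" if "i \<le> k" for i
        using that by (simp add: n antipode_def less_Suc_eq_le)
      obtain i where i: "i \<le> k" "\<bar>v i\<bar> = int \<rho>"
        using v by (auto simp: cube_sphere_def)
      have "\<bar>v i + u i\<bar> \<le> 2 * int k"
        using near by (simp add: near_def antipode_def)
      with i eq[OF i(1)] \<rho> show False
        by simp
    qed
    then consider "r u < r v" | "r v < r u"
      by linarith
    then show ?thesis
      using less[OF v near] less[OF u near'] by (cases; metis)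
  qed

  \<comment> \<open>Looking at a neighbourhood makes \<open>lab j\<close> constant on any small simplex that has a vertex of
    colour \<open>j\<close>.\<close>
  define touches where
    "touches j v \<longleftrightarrow> (\<exists>u\<in>cube_sphere k \<rho>. near k v u \<and> f (r u) = j)" for j v
  define lab :: "nat \<Rightarrow> (nat \<Rightarrow> int) \<Rightarrow> bit" where
    "lab j v = (if touches j v then 1 else if touches j (antipode v) then 0
       else if r v > 0 then 1 else 0)" for j v
  \<comment> \<open>Otherwise colour \<open>j\<close> would occur near \<open>v\<close> and near its
    antipode, at two points within \<open>2 * k\<close> of being antipodal.\<close>
  have excl: "\<not> touches j (antipode v)" if "touches j v" for j v
  proof
    assume "touches j (antipode v)"
    then obtain u' where u': "u' \<in> cube_sphere k \<rho>" "near k (antipode v) u'" "f (r u') = j"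
      by (auto simp: touches_def)
    obtain u where u: "u \<in> cube_sphere k \<rho>" "near k v u" "f (r u) = j"
      using \<open>touches j v\<close> by (auto simp: touches_def)
    have "near (2 * k) u (antipode u')"
      unfolding near_def antipode_def
    proof
      fix i
      have "\<bar>v i - u i\<bar> \<le> int k" "\<bar>- v i - u' i\<bar> \<le> int k"
        using u(2) u'(2) by (auto simp: near_def antipode_def)
      then show "\<bar>u i - - u' i\<bar> \<le> int (2 * k)"
        by linarith
    qed
    from distinct[OF u(1) u'(1) this] u(3) u'(3) show False
      by simp
  qed
  have odd: "lab j (antipode v) = lab j v + 1" if "v \<in> cube_sphere k \<rho>" for j v
  proof -
    have "r v \<noteq> 0" "r (antipode v) = - r v"
      using avoid[OF that] by (auto simp: r_def combination_antipode)
    then show ?thesis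
      using excl[of j v] by (auto simp: lab_def)
  qed

  \<comment> \<open>Colour 1 goes to the leading factor, shifted by 1 so that it vanishes where
    \<open>lab 1\<close> is 1; the other \<open>n - 1\<close> labels match the dimension
    \<open>k\<close>.\<close>
  define ws where "ws = map lab [2..<Suc n]"
  have len: "length ws = k"
    by (simp add: ws_def n del: upt_Suc)
  have "w (antipode v) = w v + 1"
    if "w \<in> set ((\<lambda>v. lab 1 v + 1) # ws)" "v \<in> cube_sphere k \<rho>" for w v
    using that odd by (auto simp: ws_def)
  then obtain \<sigma> where \<sigma>: "length \<sigma> = Suc k" "set \<sigma> \<subseteq> cube_sphere k \<rho>"
    "\<And>v u. v \<in> set \<sigma> \<Longrightarrow> u \<in> set \<sigma> \<Longrightarrow> near k v u" "lab 1 (\<sigma> ! 0) + 1 = 1"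
    "\<And>i. i < k \<Longrightarrow> (ws ! i) (\<sigma> ! i) \<noteq> (ws ! i) (\<sigma> ! Suc i)"
    using odd_functions_alternating_simplex[OF len, of "\<lambda>v. lab 1 v + 1" \<rho>] by blast
  \<comment> \<open>All vertices lie within \<open>k\<close> of the first, so \<open>lab j\<close>
    is 1 on the whole simplex.\<close>
  define j where "j = f (r (\<sigma> ! 0))"
  have lab1: "lab j (\<sigma> ! i) = 1" if "i \<le> k" for i
  proof -
    have "\<sigma> ! i \<in> set \<sigma>" "\<sigma> ! 0 \<in> set \<sigma>"
      using that \<sigma>(1) by auto
    then have "touches j (\<sigma> ! i)"
      unfolding touches_def j_def using \<sigma>(2,3) by blast
    then show ?thesis
      by (simp add: lab_def)
  qed
  have "j \<ge> 1" "j \<le> n"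
    using assms(2) by (auto simp: j_def)
  show False
  proof (cases "j = 1")
    case True
    with lab1[of 0] \<sigma>(4) show False by simp
  next
    case False
    \<comment> \<open>The labels in \<open>ws\<close> start at colour 2, so \<open>lab j\<close>
      would have to change along edge \<open>j - 2\<close>.\<close>
    then have "2 + (j - 2) = j" "j - 2 < k"
      using \<open>j \<ge> 1\<close> \<open>j \<le> n\<close> n by linarith+
    then have j: "j - 2 < k" "ws ! (j - 2) = lab j"
      by (simp_all add: ws_def n nth_map_upt del: upt_Suc)
    from \<sigma>(5)[OF j(1)] lab1[of "j - 2"] lab1[of "Suc (j - 2)"] j show False
      by simp
  qed
qed

end
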